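(* Identify $\mathbb{Z}^4$ with $\mathbb{H}(\mathbb{Z})$ via $(x,y,z,t)\mapsto x+yi+zj+tk$. Let $q_1,q_2\in\mathbb{H}(\mathbb{Z})$ be odd integer quaternions, neither of which is right-divisible in $\mathbb{H}(\mathbb{Z})$ by any quaternion $\alpha+\beta i$ with $\alpha,\beta\in\mathbb{Z}$ and $\alpha^2+\beta^2>1$. Let $u=q_1 j\overline{q_2}=(u_1,u_2,u_3,u_4)$ and $v=q_1 k\overline{q_2}=(v_1,v_2,v_3,v_4)$, and let $\square=\mathrm{conv}\{0,u,v,u+v\}$. Then the area of a fundamental domain of the lattice $\mathbb{Z}^4\cap\operatorname{span}_{\mathbb{R}}\{u,v\}$ equals $\operatorname{lcm}(N(q_1),N(q_2))$, and the Ehrhart polynomial of $\square$ is $$E_\square(t)=\gcd(N(q_1),N(q_2))\,t^2+(D_1+D_2)\,t+1,$$ where $D_1=\gcd(u_1,u_2,u_3,u_4)$ and $D_2=\gcd(v_1,v_2,v_3,v_4)$.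
   Context: $\mathbb{H}(\mathbb{Z})$ denotes quaternions $x+yi+zj+tk$ with $x,y,z,t\in\mathbb{Z}$, with $i^2=j^2=k^2=-1$, $ij=-ji=k$, $jk=-kj=i$, $ki=-ik=j$; $\overline{q}=x-yi-zj-tk$ and $N(q)=x^2+y^2+z^2+t^2$. A quaternion $q$ is odd if $N(q)$ is odd. Right-divisible by $\pi$ means $q=q'\pi$ with $q'\in\mathbb{H}(\mathbb{Z})$. The Ehrhart polynomial of a lattice polytope $P\subset\mathbb{R}^4$ is the polynomial $E_P$ with $E_P(t)=\#(tP\cap\mathbb{Z}^4)$ for all positive integers $t$. *)

theory Defs
  imports "HOL-Analysis.Analysis"
begin

text \<open>Integer quaternions x + y i + z j + t k.\<close>
datatype hq = HQ int int int int

fun hq_mult :: "hq \<Rightarrow> hq \<Rightarrow> hq" where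
  "hq_mult (HQ a1 b1 c1 d1) (HQ a2 b2 c2 d2) =
     HQ (a1*a2 - b1*b2 - c1*c2 - d1*d2)
        (a1*b2 + b1*a2 + c1*d2 - d1*c2)
        (a1*c2 - b1*d2 + c1*a2 + d1*b2)
        (a1*d2 + b1*c2 - c1*b2 + d1*a2)"

fun hq_cnj :: "hq \<Rightarrow> hq" where
  "hq_cnj (HQ x y z t) = HQ x (-y) (-z) (-t)"

fun hq_norm :: "hq \<Rightarrow> int" where
  "hq_norm (HQ x y z t) = x^2 + y^2 + z^2 + t^2"

definition hq_i :: hq where "hq_i = HQ 0 1 0 0"
definition hq_j :: hq where "hq_j = HQ 0 0 1 0"
definition hq_k :: hq where "hq_k = HQ 0 0 0 1"

definition hq_odd :: "hq \<Rightarrow> bool" where "hq_odd q \<longleftrightarrow> odd (hq_norm q)"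

definition hq_right_dvd :: "hq \<Rightarrow> hq \<Rightarrow> bool" where
  "hq_right_dvd p q \<longleftrightarrow> (\<exists>q'. q = hq_mult q' p)"

fun hq_vec :: "hq \<Rightarrow> real^4" where
  "hq_vec (HQ x y z t) = vector [of_int x, of_int y, of_int z, of_int t]"

fun hq_content :: "hq \<Rightarrow> int" where
  "hq_content (HQ x y z t) = gcd x (gcd y (gcd z t))"

definition int_lattice :: "(real^4) set" where
  "int_lattice = {x. \<forall>i. x $ i \<in> \<int>}"

definition lattice_basis2 :: "(real^4) set \<Rightarrow> real^4 \<Rightarrow> real^4 \<Rightarrow> bool" where
  "lattice_basis2 L w1 w2 \<longleftrightarrow>
     (\<forall>a b :: real. a *\<^sub>R w1 + b *\<^sub>R w2 = 0 \<longrightarrow> a = 0 \<and> b = 0) \<and>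
     L = {of_int a *\<^sub>R w1 + of_int b *\<^sub>R w2 | a b :: int. True}"

text \<open>Area of the fundamental parallelogram spanned by w1, w2 (sqrt of Gram determinant).\<close>
definition par_area :: "real^4 \<Rightarrow> real^4 \<Rightarrow> real" where
  "par_area w1 w2 = sqrt ((w1 \<bullet> w1) * (w2 \<bullet> w2) - (w1 \<bullet> w2)^2)"

end

theory Submission
  imports Defs
begin

text \<open>
  The vectors u and v are orthogonal of norm \<open>N1 N2\<close>, so everything reduces to the gcd of the
  2 x 2 minors of (u, v), which is the index of \<open>\<int>u + \<int>v\<close> in the lattice L. Sums and differences of
  complementary minors are the coordinates of \<open>v cnj u = N2 (q1 i cnj q1)\<close> and
  \<open>cnj u v = - N1 (q2 i cnj q2)\<close>. The divisibility hypothesis makes \<open>q1 i cnj q1\<close> and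
  \<open>q2 i cnj q2\<close> primitive, so that this gcd is \<open>gcd N1 N2\<close>. The lattice points are counted line by line
  in a basis of L whose first vector is the primitive vector along u.
\<close>

section \<open>Gaussian integers and primitivity\<close>

text \<open>Taken inside the complex numbers, so that exact quotients and the modulus are at hand
  for Euclidean division.\<close>

definition gauss_int :: "complex set" where
  "gauss_int = {z. Re z \<in> \<int> \<and> Im z \<in> \<int>}"

lemma gauss_int_closed:
  assumes "z \<in> gauss_int" "w \<in> gauss_int"
  shows "z + w \<in> gauss_int" "z - w \<in> gauss_int" "z * w \<in> gauss_int"
  using assms by (auto simp: gauss_int_def)

lemma cnj_gauss_int: "z \<in> gauss_int \<Longrightarrow> cnj z \<in> gauss_int"
  by (simp add: gauss_int_def)

lemma Complex_of_int_gauss_int: "Complex (of_int a) (of_int b) \<in> gauss_int"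
  by (simp add: gauss_int_def)

lemma gauss_int_obtain:
  assumes "z \<in> gauss_int"
  obtains a b :: int where "z = Complex (of_int a) (of_int b)"
  using assms by (metis (mono_tags, lifting) Ints_cases complex_surj gauss_int_def mem_Collect_eq)

text \<open>Rounding both coordinates of the exact quotient moves it by a squared distance of at
  most 1/4 + 1/4 < 1.\<close>

lemma gauss_int_division:
  assumes "b \<noteq> 0"
  obtains q where "q \<in> gauss_int" "cmod (a - q * b) < cmod b"
proof -
  define q where "q = Complex (of_int (round (Re (a / b)))) (of_int (round (Im (a / b))))"
  have "\<bar>Re (a / b - q)\<bar> \<le> 1/2" "\<bar>Im (a / b - q)\<bar> \<le> 1/2"
    using of_int_round_abs_le[of "Re (a / b)"] of_int_round_abs_le[of "Im (a / b)"]
    by (auto simp: q_def abs_minus_commute)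
  then have "(Re (a / b - q))\<^sup>2 \<le> (1/2)\<^sup>2" "(Im (a / b - q))\<^sup>2 \<le> (1/2)\<^sup>2"
    by (simp_all only: power2_le_iff_abs_le)
  then have "(cmod (a / b - q))\<^sup>2 < 1\<^sup>2"
    unfolding cmod_power2 by (simp add: power_divide)
  then have "cmod (a / b - q) < 1"
    using power2_less_imp_less by fastforce
  moreover have "a - q * b = (a / b - q) * b"
    using assms by (simp add: field_simps)
  ultimately have "cmod (a - q * b) < cmod b"
    using assms by (simp add: norm_mult)
  moreover have "q \<in> gauss_int" by (simp add: q_def Complex_of_int_gauss_int)
  ultimately show thesis using that by blast
qed

text \<open>The ideal \<open>I\<close> generated by z and w is principal: remainders of Euclidean
  division by a nonzero element of least modulus stay in \<open>I\<close> and are smaller, hence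
  vanish.\<close>

lemma gauss_int_bezout:
  assumes "z \<in> gauss_int" "w \<in> gauss_int" "z \<noteq> 0 \<or> w \<noteq> 0"
  obtains g x y s t where "g \<noteq> 0" "g \<in> gauss_int" "x \<in> gauss_int" "y \<in> gauss_int"
    "s \<in> gauss_int" "t \<in> gauss_int" "g = x * z + y * w" "z = s * g" "w = t * g"
proof -
  define I where "I = {x * z + y * w | x y. x \<in> gauss_int \<and> y \<in> gauss_int}"
  have zero_one: "0 \<in> gauss_int" "1 \<in> gauss_int" by (auto simp: gauss_int_def)
  have zI: "z \<in> I" unfolding I_def using zero_one by force
  have wI: "w \<in> I" unfolding I_def using zero_one by force
  have I_sub: "I \<subseteq> gauss_int" unfolding I_def using assms by (auto intro!: gauss_int_closed)
  have I_closed: "a - q * b \<in> I" if "a \<in> I" "b \<in> I" "q \<in> gauss_int" for a b q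
  proof -
    from that obtain x y x' y' where h: "x \<in> gauss_int" "y \<in> gauss_int" "x' \<in> gauss_int" "y' \<in> gauss_int"
      "a = x * z + y * w" "b = x' * z + y' * w" unfolding I_def by auto
    have "a - q * b = (x - q * x') * z + (y - q * y') * w" using h by (simp add: algebra_simps)
    moreover have "x - q * x' \<in> gauss_int" "y - q * y' \<in> gauss_int"
      using h that(3) by (auto intro!: gauss_int_closed)
    ultimately show ?thesis unfolding I_def by blast
  qed
  \<comment> \<open>On Gaussian integers the squared modulus is already an integer, so the floor
    loses nothing and a least value exists.\<close>
  define size where "size a = nat \<lfloor>(cmod a)\<^sup>2\<rfloor>" for a
  have size_less: "size a < size b" if ab: "a \<in> gauss_int" "b \<in> gauss_int" "cmod a < cmod b" for a b
  proof -
    obtain m n :: int where a: "a = Complex m n" using ab(1) gauss_int_obtain by blast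
    obtain m' n' :: int where b: "b = Complex m' n'" using ab(2) gauss_int_obtain by blast
    note e = a b
    have "(cmod a)\<^sup>2 < (cmod b)\<^sup>2" using ab(3) by (simp add: power_strict_mono)
    then have "real_of_int (m\<^sup>2 + n\<^sup>2) < real_of_int (m'\<^sup>2 + n'\<^sup>2)" by (simp add: e cmod_power2)
    moreover have "(cmod a)\<^sup>2 = real_of_int (m\<^sup>2 + n\<^sup>2)" "(cmod b)\<^sup>2 = real_of_int (m'\<^sup>2 + n'\<^sup>2)"
      by (auto simp: e cmod_power2)
    ultimately show ?thesis unfolding size_def
      by (smt (verit) floor_of_int nat_less_eq_zless of_int_less_iff sum_power2_ge_zero)
  qed
  have "\<exists>a. a \<in> I \<and> a \<noteq> 0" using zI wI assms(3) by blast
  then obtain g where g: "g \<in> I" "g \<noteq> 0" and min: "\<And>a. a \<in> I \<Longrightarrow> a \<noteq> 0 \<Longrightarrow> size g \<le> size a"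
    using ex_has_least_nat[of "\<lambda>a. a \<in> I \<and> a \<noteq> 0" _ size] by blast
  have div: "\<exists>q\<in>gauss_int. a = q * g" if "a \<in> I" for a
  proof -
    obtain q where q: "q \<in> gauss_int" "cmod (a - q * g) < cmod g"
      using gauss_int_division[OF g(2)] by blast
    have "a - q * g \<in> I" using I_closed that g(1) q(1) by blast
    then have "a - q * g = 0" using min size_less[OF _ _ q(2)] I_sub g(1) by (meson in_mono leD)
    then show ?thesis using q(1) by auto
  qed
  obtain x y where xy: "x \<in> gauss_int" "y \<in> gauss_int" "g = x * z + y * w"
    using g(1) unfolding I_def by blast
  obtain s where s: "s \<in> gauss_int" "z = s * g" using div[OF zI] by blast
  obtain t where t: "t \<in> gauss_int" "w = t * g" using div[OF wI] by blast
  have "g \<in> gauss_int" using g(1) I_sub by blast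
  then show thesis by (rule that[OF g(2) _ xy(1,2) s(1) t(1) xy(3) s(2) t(2)])
qed

lemma hq_content_dvd_iff:
  "d dvd hq_content (HQ x y z t) \<longleftrightarrow> d dvd x \<and> d dvd y \<and> d dvd z \<and> d dvd t"
  by auto

lemma hq_content_nonneg: "hq_content q \<ge> 0"
  by (cases q) simp

lemma gauss_int_of_int_dvd:
  fixes D a b :: int
  assumes "Complex (of_int a) (of_int b) = of_int D * s" "s \<in> gauss_int"
  shows "D dvd a" "D dvd b"
proof -
  obtain m n :: int where "s = Complex m n" using assms(2) gauss_int_obtain by blast
  then have "real_of_int a = real_of_int (D * m)" "real_of_int b = real_of_int (D * n)"
    using assms(1) by (auto simp: complex_eq_iff)
  then show "D dvd a" "D dvd b" by (metis dvd_triv_left of_int_eq_iff)+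
qed

text \<open>Write q = z + w j with Gaussian integers z, w. Right division of q by \<open>\<pi>\<close> means that \<open>\<pi>\<close>
  divides both z and \<open>cnj w\<close>, so the hypothesis says that z and \<open>cnj w\<close> are coprime. The entries
  of \<open>q i cnj q\<close> are \<open>z cnj z - w cnj w\<close> and, up to a unit, \<open>2 z w\<close>; a common divisor of them therefore divides
  z and w.\<close>

lemma hq_content_conj_i:
  assumes odd: "hq_odd q"
    and ndvd: "\<And>\<alpha> \<beta>. \<alpha>^2 + \<beta>^2 > 1 \<Longrightarrow> \<not> hq_right_dvd (HQ \<alpha> \<beta> 0 0) q"
  shows "hq_content (hq_mult (hq_mult q hq_i) (hq_cnj q)) = 1"
proof -
  obtain a b c d where q: "q = HQ a b c d" by (cases q)
  define D where "D = hq_content (hq_mult (hq_mult q hq_i) (hq_cnj q))"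
  define A1 A2 A3 N where "A1 = a\<^sup>2 + b\<^sup>2 - c\<^sup>2 - d\<^sup>2" and "A2 = 2 * (b * c + a * d)"
    and "A3 = 2 * (b * d - a * c)" and "N = a\<^sup>2 + b\<^sup>2 + c\<^sup>2 + d\<^sup>2"
  have "hq_mult (hq_mult q hq_i) (hq_cnj q) = HQ 0 A1 A2 A3"
    by (simp add: q hq_i_def A1_def A2_def A3_def power2_eq_square algebra_simps)
  then have dA: "D dvd A1" "D dvd A2" "D dvd A3"
    using hq_content_dvd_iff[of D 0 A1 A2 A3] by (auto simp: D_def)
  \<comment> \<open>The norm of \<open>q i cnj q\<close> is \<open>N\<^sup>2\<close>, so D divides N
    and is odd.\<close>
  have "N\<^sup>2 = A1\<^sup>2 + A2\<^sup>2 + A3\<^sup>2"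
    by (simp add: A1_def A2_def A3_def N_def power2_eq_square algebra_simps)
  then have "D\<^sup>2 dvd N\<^sup>2" using dA by (simp add: dvd_add dvd_power_same)
  then have DN: "D dvd N" by simp
  have oN: "odd N" using odd by (simp add: hq_odd_def q N_def)
  then have cop: "coprime D 2" using DN by (meson coprime_right_2_iff_odd dvd_trans)
  \<comment> \<open>\<open>N + A1\<close> and \<open>N - A1\<close> are twice the norms of z and w.
    The factor 2 cancels because D is odd, here and in \<open>A2\<close>, \<open>A3\<close>.\<close>
  have "D dvd 2 * (a\<^sup>2 + b\<^sup>2)" "D dvd 2 * (c\<^sup>2 + d\<^sup>2)"
    using dvd_add[OF DN dA(1)] dvd_diff[OF DN dA(1)] by (auto simp: N_def A1_def)
  then have "D dvd a\<^sup>2 + b\<^sup>2" "D dvd c\<^sup>2 + d\<^sup>2" "D dvd b * c + a * d" "D dvd b * d - a * c"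
    using cop dA(2,3) unfolding A2_def A3_def by (simp_all only: coprime_dvd_mult_right_iff)
  then obtain k1 k2 k3 k4 where k: "a\<^sup>2 + b\<^sup>2 = D * k1" "c\<^sup>2 + d\<^sup>2 = D * k2"
    "b * c + a * d = D * k3" "b * d - a * c = D * k4" by (auto elim!: dvdE)
  define z w where "z = Complex (of_int a) (of_int b)" and "w = Complex (of_int c) (of_int d)"
  have zw: "z \<in> gauss_int" "w \<in> gauss_int" by (auto simp: z_def w_def Complex_of_int_gauss_int)
  have nz: "z \<noteq> 0 \<or> cnj w \<noteq> 0"
    using oN by (auto simp: z_def w_def N_def complex_eq_iff)
  \<comment> \<open>The quotient of \<open>z * w\<close> by D: the real part of \<open>z * w\<close>
    is \<open>a * c - b * d\<close>, hence the sign.\<close>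
  define kk where "kk = Complex (- of_int k4) (of_int k3)"
  have kG: "of_int k1 \<in> gauss_int" "of_int k2 \<in> gauss_int" "kk \<in> gauss_int"
    by (auto simp: gauss_int_def kk_def)
  have kr: "real_of_int a ^2 + real_of_int b^2 = of_int D * of_int k1"
    "real_of_int c ^2 + real_of_int d^2 = of_int D * of_int k2"
    "real_of_int b * real_of_int c + real_of_int a * real_of_int d = of_int D * of_int k3"
    "real_of_int b * real_of_int d - real_of_int a * real_of_int c = of_int D * of_int k4"
    using k by (metis of_int_add of_int_mult of_int_power of_int_diff)+
  have e: "z * cnj z = of_int D * of_int k1" "w * cnj w = of_int D * of_int k2" "z * w = of_int D * kk"
    using kr by (auto simp: z_def w_def kk_def complex_eq_iff power2_eq_square algebra_simps)
  obtain g x y s t where g: "g \<noteq> 0" "g \<in> gauss_int" "x \<in> gauss_int" "y \<in> gauss_int"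
    "s \<in> gauss_int" "t \<in> gauss_int" "g = x * z + y * cnj w" "z = s * g" "cnj w = t * g"
    using gauss_int_bezout[OF zw(1) cnj_gauss_int[OF zw(2)] nz] by metis
  obtain \<alpha> \<beta> :: int where ab: "g = Complex \<alpha> \<beta>" using g(2) gauss_int_obtain by blast
  obtain s1 s2 :: int where s: "s = Complex s1 s2" using g(5) gauss_int_obtain by blast
  obtain t1 t2 :: int where t: "t = Complex t1 t2" using g(6) gauss_int_obtain by blast
  have "real_of_int a = of_int (s1 * \<alpha> - s2 * \<beta>)" "real_of_int b = of_int (s1 * \<beta> + s2 * \<alpha>)"
    "real_of_int c = of_int (t1 * \<alpha> - t2 * \<beta>)" "real_of_int d = of_int (- (t1 * \<beta> + t2 * \<alpha>))"
    using g(8,9) by (auto simp: z_def w_def s t ab complex_eq_iff)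
  then have "a = s1 * \<alpha> - s2 * \<beta>" "b = s1 * \<beta> + s2 * \<alpha>"
    "c = t1 * \<alpha> - t2 * \<beta>" "d = - (t1 * \<beta> + t2 * \<alpha>)" by (simp_all only: of_int_eq_iff)
  \<comment> \<open>Since \<open>w = cnj t * cnj g\<close> and \<open>cnj g\<close> j = j g, the
    quaternion z + w j equals (s + \<open>cnj t\<close> j) g.\<close>
  then have "q = hq_mult (HQ s1 s2 t1 (-t2)) (HQ \<alpha> \<beta> 0 0)" by (simp add: q)
  then have "\<alpha>\<^sup>2 + \<beta>\<^sup>2 \<le> 1" using ndvd unfolding hq_right_dvd_def by (metis not_less)
  moreover have "\<alpha>\<^sup>2 + \<beta>\<^sup>2 > 0" using g(1) by (auto simp: ab complex_eq_iff sum_power2_gt_zero_iff)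
  ultimately have "\<alpha>\<^sup>2 + \<beta>\<^sup>2 = 1" by simp
  then have "real_of_int (\<alpha>\<^sup>2 + \<beta>\<^sup>2) = 1" by (simp only: of_int_1)
  then have unit: "g * cnj g = 1" by (simp add: ab complex_eq_iff power2_eq_square)
  have cg: "cnj g = cnj x * cnj z + cnj y * w" by (simp add: g(7))
  \<comment> \<open>As g is a unit, z may be multiplied by \<open>cnj g * g\<close>; expanding
    \<open>cnj g\<close> by the Bezout identity leaves only \<open>z * cnj z\<close> and
    \<open>z * w\<close>, both multiples of D. For w the factor g is expanded instead.\<close>
  have "z = z * cnj g * g" using unit by (metis mult.assoc mult.commute mult_1_right)
  also have "\<dots> = (cnj x * (z * cnj z) + cnj y * (z * w)) * g" by (simp only: cg) (simp add: algebra_simps)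
  also have "\<dots> = of_int D * ((cnj x * of_int k1 + cnj y * kk) * g)"
    by (simp only: e) (simp add: algebra_simps)
  finally have 1: "z = of_int D * ((cnj x * of_int k1 + cnj y * kk) * g)" .
  have "w * g = x * (z * w) + y * (w * cnj w)" by (simp only: g(7)) (simp add: algebra_simps)
  then have "w * g * cnj g = (x * (z * w) + y * (w * cnj w)) * cnj g" by (simp only:)
  then have "w = (x * (z * w) + y * (w * cnj w)) * cnj g" by (simp only: mult.assoc unit mult_1_right)
  also have "\<dots> = of_int D * ((x * kk + y * of_int k2) * cnj g)"
    by (simp only: e) (simp add: algebra_simps)
  finally have 2: "w = of_int D * ((x * kk + y * of_int k2) * cnj g)" .
  have "D dvd a" "D dvd b"
    by (rule gauss_int_of_int_dvd[OF 1[unfolded z_def]];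
        intro gauss_int_closed cnj_gauss_int g(2-4) kG)+
  moreover have "D dvd c" "D dvd d"
    by (rule gauss_int_of_int_dvd[OF 2[unfolded w_def]];
        intro gauss_int_closed cnj_gauss_int g(2-4) kG)+
  ultimately obtain a' b' c' d' where "a = a' * D" "b = b' * D" "c = c' * D" "d = d' * D"
    by (metis dvdE mult.commute)
  \<comment> \<open>The divisibility hypothesis is used a second time, now with the rational integer
    D as divisor.\<close>
  then have "q = hq_mult (HQ a' b' c' d') (HQ D 0 0 0)" by (simp add: q)
  then have "D\<^sup>2 + 0\<^sup>2 \<le> 1" using ndvd unfolding hq_right_dvd_def by (metis not_less)
  moreover have "D \<noteq> 0" using DN oN by auto
  moreover have "D \<ge> 0" by (simp add: D_def hq_content_nonneg)
  ultimately have "D = 1"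
    by (smt (verit) power2_eq_square mult_le_cancel_left1 power_zero_numeral)
  then show ?thesis by (simp add: D_def)
qed

section \<open>The minors of u and v\<close>

lemma hq_norm_mult: "hq_norm (hq_mult p q) = hq_norm p * hq_norm q"
  by (cases p; cases q) (simp add: power2_eq_square algebra_simps)

text \<open>The Pluecker coordinates of the pair.\<close>

fun hq_minors :: "hq \<Rightarrow> hq \<Rightarrow> int list" where
  "hq_minors (HQ a b c d) (HQ a' b' c' d') =
    [a * b' - b * a', a * c' - c * a', a * d' - d * a', b * c' - c * b', b * d' - d * b', c * d' - d * c']"

text \<open>Multiplying a primitive vector by n gives content \<open>\<bar>n\<bar>\<close>, and d
  divides that content.\<close>

lemma dvd_mult_hq_content:
  assumes "d dvd n * x" "d dvd n * y" "d dvd n * z" "d dvd n * t" "hq_content (HQ x y z t) = 1"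
  shows "d dvd (n::int)"
proof -
  have dist: "gcd (n * a) (n * b) = \<bar>n * gcd a b\<bar>" for a b :: int
    by (simp add: gcd_mult_left abs_mult)
  have "d dvd gcd (gcd (n * x) (n * y)) (gcd (n * z) (n * t))" using assms by simp
  then have "d dvd n * gcd (gcd x y) (gcd z t)" unfolding dist by (simp add: dist)
  moreover have "gcd (gcd x y) (gcd z t) = 1" using assms(5) by (simp add: gcd.assoc)
  ultimately show ?thesis by simp
qed

text \<open>Quantifying over divisors d identifies the gcd of the minors. One direction strips the
  primitive vectors from the sums and differences of complementary minors; the other recovers each
  minor as a half-sum or half-difference, where oddness of d removes the 2.\<close>

lemma dvd_minors_iff:
  assumes o: "odd (hq_norm q1)"
    and c1: "hq_content (hq_mult (hq_mult q1 hq_i) (hq_cnj q1)) = 1"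
    and c2: "hq_content (hq_mult (hq_mult q2 hq_i) (hq_cnj q2)) = 1"
  shows "(\<forall>m \<in> set (hq_minors (hq_mult (hq_mult q1 hq_j) (hq_cnj q2)) (hq_mult (hq_mult q1 hq_k) (hq_cnj q2))). d dvd m)
     \<longleftrightarrow> d dvd gcd (hq_norm q1) (hq_norm q2)"
proof -
  obtain a1 b1 c1 d1 a2 b2 c2 d2 where q: "q1 = HQ a1 b1 c1 d1" "q2 = HQ a2 b2 c2 d2"
    by (cases q1, cases q2)
  obtain x0 x1 x2 x3 where A: "hq_mult (hq_mult q1 hq_i) (hq_cnj q1) = HQ x0 x1 x2 x3"
    by (cases "hq_mult (hq_mult q1 hq_i) (hq_cnj q1)")
  obtain y0 y1 y2 y3 where B: "hq_mult (hq_mult q2 hq_i) (hq_cnj q2) = HQ y0 y1 y2 y3"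
    by (cases "hq_mult (hq_mult q2 hq_i) (hq_cnj q2)")
  obtain u0 u1 u2 u3 where u: "hq_mult (hq_mult q1 hq_j) (hq_cnj q2) = HQ u0 u1 u2 u3"
    by (cases "hq_mult (hq_mult q1 hq_j) (hq_cnj q2)")
  obtain v0 v1 v2 v3 where v: "hq_mult (hq_mult q1 hq_k) (hq_cnj q2) = HQ v0 v1 v2 v3"
    by (cases "hq_mult (hq_mult q1 hq_k) (hq_cnj q2)")
  \<comment> \<open>Oriented so that \<open>eqs\<close> rewrites the named coordinates into
    polynomials in the coordinates of q1 and q2.\<close>
  have inj: "HQ a b c d = HQ a' b' c' d' \<Longrightarrow> a' = a" "HQ a b c d = HQ a' b' c' d' \<Longrightarrow> b' = b"
    "HQ a b c d = HQ a' b' c' d' \<Longrightarrow> c' = c" "HQ a b c d = HQ a' b' c' d' \<Longrightarrow> d' = d"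
    for a b c d a' b' c' d' by simp_all
  note eqs = inj[OF A[unfolded q hq_i_def hq_mult.simps hq_cnj.simps]]
    inj[OF B[unfolded q hq_i_def hq_mult.simps hq_cnj.simps]]
    inj[OF u[unfolded q hq_j_def hq_mult.simps hq_cnj.simps]]
    inj[OF v[unfolded q hq_k_def hq_mult.simps hq_cnj.simps]]
  define N1 N2 where "N1 = hq_norm q1" and "N2 = hq_norm q2"
  have zero: "x0 = 0" "y0 = 0" using eqs by (auto simp: algebra_simps)
  \<comment> \<open>The imaginary parts of \<open>v cnj u = N2 (q1 i cnj q1)\<close> and \<open>cnj u v = - N1 (q2 i cnj q2)\<close>.\<close>
  have plus: "(u0 * v1 - u1 * v0) + (u2 * v3 - u3 * v2) = N2 * x1"
      "(u0 * v2 - u2 * v0) - (u1 * v3 - u3 * v1) = N2 * x2"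
      "(u0 * v3 - u3 * v0) + (u1 * v2 - u2 * v1) = N2 * x3"
    and minus: "(u0 * v1 - u1 * v0) - (u2 * v3 - u3 * v2) = - N1 * y1"
      "(u0 * v2 - u2 * v0) + (u1 * v3 - u3 * v1) = - N1 * y2"
      "(u0 * v3 - u3 * v0) - (u1 * v2 - u2 * v1) = - N1 * y3"
    unfolding N1_def N2_def q hq_norm.simps eqs by (simp_all add: power2_eq_square algebra_simps)
  show ?thesis unfolding u v N1_def[symmetric] N2_def[symmetric]
  proof
    assume "\<forall>m \<in> set (hq_minors (HQ u0 u1 u2 u3) (HQ v0 v1 v2 v3)). d dvd m"
    then have m: "d dvd u0 * v1 - u1 * v0" "d dvd u0 * v2 - u2 * v0" "d dvd u0 * v3 - u3 * v0"
      "d dvd u1 * v2 - u2 * v1" "d dvd u1 * v3 - u3 * v1" "d dvd u2 * v3 - u3 * v2" by auto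
    have "d dvd N2 * x1" "d dvd N2 * x2" "d dvd N2 * x3"
      unfolding plus[symmetric] by (intro dvd_add dvd_diff m)+
    then have "d dvd N2" using dvd_mult_hq_content[of d N2 x0 x1 x2 x3] c1 A zero by simp
    moreover have "d dvd - N1 * y1" "d dvd - N1 * y2" "d dvd - N1 * y3"
      unfolding minus[symmetric] by (intro dvd_add dvd_diff m)+
    then have "d dvd N1" using dvd_mult_hq_content[of d N1 y0 y1 y2 y3] c2 B zero by simp
    ultimately show "d dvd gcd N1 N2" by simp
  next
    assume "d dvd gcd N1 N2"
    then have d: "d dvd N1" "d dvd N2" by simp_all
    have cop: "coprime d 2"
      using d(1) o unfolding N1_def by (meson coprime_right_2_iff_odd dvd_trans)
    have half: "d dvd m" if "2 * m = N2 * x + N1 * y" for m x y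
    proof -
      have "d dvd 2 * m" using that d by simp
      then show ?thesis using cop by (simp only: coprime_dvd_mult_right_iff)
    qed
    have "d dvd u0 * v1 - u1 * v0" by (rule half[of _ "x1" "-y1"]) (use plus(1) minus(1) in algebra)
    moreover have "d dvd u2 * v3 - u3 * v2" by (rule half[of _ "x1" "y1"]) (use plus(1) minus(1) in algebra)
    moreover have "d dvd u0 * v2 - u2 * v0" by (rule half[of _ "x2" "-y2"]) (use plus(2) minus(2) in algebra)
    moreover have "d dvd u1 * v3 - u3 * v1" by (rule half[of _ "-x2" "-y2"]) (use plus(2) minus(2) in algebra)
    moreover have "d dvd u0 * v3 - u3 * v0" by (rule half[of _ "x3" "-y3"]) (use plus(3) minus(3) in algebra)
    moreover have "d dvd u1 * v2 - u2 * v1" by (rule half[of _ "x3" "y3"]) (use plus(3) minus(3) in algebra)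
    ultimately show "\<forall>m \<in> set (hq_minors (HQ u0 u1 u2 u3) (HQ v0 v1 v2 v3)). d dvd m" by simp
  qed
qed

section \<open>Counting lattice points\<close>

lemma vector_4:
  "(vector [x, y, z, t] :: 'a::zero^4) $ 1 = x" "(vector [x, y, z, t] :: 'a::zero^4) $ 2 = y"
  "(vector [x, y, z, t] :: 'a::zero^4) $ 3 = z" "(vector [x, y, z, t] :: 'a::zero^4) $ 4 = t"
  unfolding vector_def by simp_all

lemma int_lattice_closed:
  assumes "x \<in> int_lattice" "y \<in> int_lattice"
  shows "x + y \<in> int_lattice" "x - y \<in> int_lattice" "of_int n *\<^sub>R x \<in> int_lattice"
  using assms by (auto simp: int_lattice_def)

lemma hq_vec_in_int_lattice: "hq_vec q \<in> int_lattice"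
  by (cases q) (auto simp: int_lattice_def forall_4 vector_4)

text \<open>By Bezout, r times a gcd is an integer exactly when r times both arguments is. The
  content is thus determined by the real multiples that stay integral, a description independent of
  coordinates.\<close>

lemma scaleR_hq_vec_in_int_lattice_iff:
  "r *\<^sub>R hq_vec q \<in> int_lattice \<longleftrightarrow> r * of_int (hq_content q) \<in> \<int>"
proof -
  obtain x y z t where q: "q = HQ x y z t" by (cases q)
  have "r * of_int (gcd m n) \<in> \<int> \<longleftrightarrow> r * of_int m \<in> \<int> \<and> r * of_int n \<in> \<int>" for m n
  proof
    assume g: "r * of_int (gcd m n) \<in> \<int>"
    obtain a b where "m = gcd m n * a" "n = gcd m n * b" by (meson dvdE gcd_dvd1 gcd_dvd2)
    then show "r * of_int m \<in> \<int> \<and> r * of_int n \<in> \<int>"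
      using g by (metis Ints_mult Ints_of_int mult.assoc of_int_mult)
  next
    assume g: "r * of_int m \<in> \<int> \<and> r * of_int n \<in> \<int>"
    obtain a b where "a * m + b * n = gcd m n" using bezout_int by blast
    then have "r * of_int (gcd m n) = of_int a * (r * of_int m) + of_int b * (r * of_int n)"
      by (metis (no_types, opaque_lifting) distrib_left mult.left_commute of_int_add of_int_mult)
    then show "r * of_int (gcd m n) \<in> \<int>" using g by auto
  qed
  then show ?thesis by (simp add: q int_lattice_def forall_4 vector_4)
qed

lemma parallelogram_hull:
  fixes u v :: "'a::real_vector"
  shows "convex hull {0, u, v, u + v} = {x *\<^sub>R u + y *\<^sub>R v | x y. 0 \<le> x \<and> x \<le> 1 \<and> 0 \<le> y \<and> y \<le> 1}"
    (is "_ = ?P")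
proof
  have "convex ?P"
  proof (rule convexI)
    fix p q :: 'a and s t :: real
    assume "p \<in> ?P" "q \<in> ?P" and st: "0 \<le> s" "0 \<le> t" "s + t = 1"
    then obtain x y x' y' where h: "0 \<le> x" "x \<le> 1" "0 \<le> y" "y \<le> 1" "0 \<le> x'" "x' \<le> 1" "0 \<le> y'" "y' \<le> 1"
      "p = x *\<^sub>R u + y *\<^sub>R v" "q = x' *\<^sub>R u + y' *\<^sub>R v" by auto
    have "s *\<^sub>R p + t *\<^sub>R q = (s * x + t * x') *\<^sub>R u + (s * y + t * y') *\<^sub>R v"
      by (simp add: h algebra_simps)
    moreover have "s * x + t * x' \<le> 1" "s * y + t * y' \<le> 1"
      using h st by (auto intro!: convex_bound_le)
    moreover have "0 \<le> s * x + t * x'" "0 \<le> s * y + t * y'" using h st by auto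
    ultimately show "s *\<^sub>R p + t *\<^sub>R q \<in> ?P" by blast
  qed
  moreover have "{0, u, v, u + v} \<subseteq> ?P"
  proof -
    have "0 = 0 *\<^sub>R u + 0 *\<^sub>R v" "u = 1 *\<^sub>R u + 0 *\<^sub>R v" "v = 0 *\<^sub>R u + 1 *\<^sub>R v" "u + v = 1 *\<^sub>R u + 1 *\<^sub>R v"
      by simp_all
    then show ?thesis by (smt (verit, best) insert_iff mem_Collect_eq singletonD subsetI)
  qed
  ultimately show "convex hull {0, u, v, u + v} \<subseteq> ?P" by (simp add: subset_hull)
next
  show "?P \<subseteq> convex hull {0, u, v, u + v}"
  proof
    fix p assume "p \<in> ?P"
    then obtain x y where h: "0 \<le> x" "x \<le> 1" "0 \<le> y" "y \<le> 1" "p = x *\<^sub>R u + y *\<^sub>R v" by auto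
    let ?H = "convex hull {0, u, v, u + v}"
    have c: "convex ?H" and m: "0 \<in> ?H" "u \<in> ?H" "v \<in> ?H" "u + v \<in> ?H"
      by (auto simp: hull_inc)
    \<comment> \<open>Bilinear interpolation: first the points at parameter x on two opposite edges,
      then the point at parameter y between them.\<close>
    have 1: "(1 - x) *\<^sub>R 0 + x *\<^sub>R u \<in> ?H" "(1 - x) *\<^sub>R v + x *\<^sub>R (u + v) \<in> ?H"
      using h by (intro convexD[OF c] m; simp)+
    have "(1 - y) *\<^sub>R ((1 - x) *\<^sub>R 0 + x *\<^sub>R u) + y *\<^sub>R ((1 - x) *\<^sub>R v + x *\<^sub>R (u + v)) \<in> ?H"
      using h by (intro convexD[OF c 1]) auto
    then show "p \<in> ?H" by (simp add: h algebra_simps)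
  qed
qed

text \<open>Dividing by \<open>g = gcd c e\<close> reduces the condition to n being a multiple of
  \<open>e' = e / g\<close>; the closed interval up to \<open>T * g * e'\<close> contains
  \<open>T * g + 1\<close> of these, 0 included.\<close>

lemma card_multiples_dvd:
  fixes c e T :: int
  assumes "e > 0" "T \<ge> 0"
  shows "int (card {n \<in> {0..T * e}. e dvd n * c}) = T * gcd c e + 1"
proof -
  define g where "g = gcd c e"
  have g: "g > 0" using assms by (simp add: g_def)
  obtain c' e' where ce: "c = c' * g" "e = e' * g" "coprime c' e'"
    using gcd_coprime_exists[of c e] g unfolding g_def by auto
  have e': "e' > 0" using ce(2) assms(1) g by (simp add: zero_less_mult_iff)
  have iff: "e dvd n * c \<longleftrightarrow> e' dvd n" for n
  proof -
    have "e dvd n * c \<longleftrightarrow> e' * g dvd (n * c') * g" using ce by (simp add: mult.assoc)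
    also have "\<dots> \<longleftrightarrow> e' dvd n * c'" using g by simp
    also have "\<dots> \<longleftrightarrow> e' dvd n" using ce(3) by (simp add: coprime_commute coprime_dvd_mult_left_iff)
    finally show ?thesis .
  qed
  have "{n \<in> {0..T * e}. e dvd n * c} = (\<lambda>k. e' * k) ` {0..T * g}"
  proof (intro set_eqI iffI)
    fix n assume "n \<in> {n \<in> {0..T * e}. e dvd n * c}"
    then obtain k where k: "n = e' * k" "0 \<le> n" "n \<le> T * e" using iff by auto
    then have "e' * k \<le> e' * (T * g)" using ce(2) by (simp add: ac_simps)
    then have "k \<le> T * g" "0 \<le> k" using e' k by (auto simp: zero_le_mult_iff)
    then show "n \<in> (\<lambda>k. e' * k) ` {0..T * g}" using k by auto
  next
    fix n assume "n \<in> (\<lambda>k. e' * k) ` {0..T * g}"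
    then obtain k where k: "n = e' * k" "0 \<le> k" "k \<le> T * g" by (metis (no_types) imageE atLeastAtMost_iff)
    then have "e' * k \<le> e' * (T * g)" using e' by simp
    then show "n \<in> {n \<in> {0..T * e}. e dvd n * c}" using k e' ce(2) iff by (auto simp: ac_simps)
  qed
  moreover have "inj_on (\<lambda>k. e' * k) {0..T * g}" using e' by (auto simp: inj_on_def)
  moreover have "0 \<le> T * g" using assms(2) g by simp
  ultimately show ?thesis by (simp add: card_image g_def)
qed

text \<open>This counts the integers in the real interval from a/e to a/e + T: there are T of them,
  and one more when the ends are integers.\<close>

lemma card_int_interval:
  fixes a e T :: int
  assumes "e > 0" "T \<ge> 0"
  shows "finite {m. a \<le> m * e \<and> m * e \<le> a + T * e}"
    "int (card {m. a \<le> m * e \<and> m * e \<le> a + T * e}) = T + of_bool (e dvd a)"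
proof -
  have le_div: "m \<le> b div e \<longleftrightarrow> m * e \<le> b" for m b
  proof
    assume "m \<le> b div e"
    then have "m * e \<le> b div e * e" using assms(1) by simp
    also have "\<dots> \<le> b" using assms(1) by (simp add: minus_mod_eq_div_mult[symmetric])
    finally show "m * e \<le> b" .
  next
    assume "m * e \<le> b"
    then show "m \<le> b div e" using zdiv_mono1[of "m * e" b e] assms(1) by simp
  qed
  \<comment> \<open>The lower end is the ceiling of a/e, obtained from the floor by
    negation.\<close>
  have "a \<le> m * e \<longleftrightarrow> a div e + of_bool (\<not> e dvd a) \<le> m" for m
  proof -
    have "a \<le> m * e \<longleftrightarrow> (- m) * e \<le> - a" by simp
    also have "\<dots> \<longleftrightarrow> - m \<le> (- a) div e" by (simp only: le_div)
    also have "\<dots> \<longleftrightarrow> a div e + of_bool (\<not> e dvd a) \<le> m"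
      using assms(1) by (auto simp: zdiv_zminus1_eq_if dvd_eq_mod_eq_0)
    finally show ?thesis .
  qed
  moreover have "m * e \<le> a + T * e \<longleftrightarrow> m \<le> a div e + T" for m
    using assms(1) le_div[of m "a + T * e"] by (simp add: add.commute)
  ultimately have eq: "{m. a \<le> m * e \<and> m * e \<le> a + T * e} = {a div e + of_bool (\<not> e dvd a) .. a div e + T}"
    by auto
  show "finite {m. a \<le> m * e \<and> m * e \<le> a + T * e}" unfolding eq by simp
  show "int (card {m. a \<le> m * e \<and> m * e \<le> a + T * e}) = T + of_bool (e dvd a)"
    unfolding eq using assms by auto
qed

text \<open>Each of the \<open>T * e + 1\<close> columns of fixed n has \<open>T * D\<close> points,
  plus one when its ends are integral, that is when e divides \<open>n * c\<close>. These extra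
  points produce the summand \<open>gcd c e\<close>.\<close>

lemma card_sheared_rectangle:
  fixes c e D T :: int
  assumes "e > 0" "D > 0" "T \<ge> 0"
  shows "int (card {(n, m). 0 \<le> n \<and> n \<le> T * e \<and> n * c \<le> m * e \<and> m * e \<le> n * c + (T * D) * e})
    = D * e * T\<^sup>2 + (D + gcd c e) * T + 1"
proof -
  have TD: "T * D \<ge> 0" using assms by simp
  let ?M = "\<lambda>n. {m. n * c \<le> m * e \<and> m * e \<le> n * c + (T * D) * e}"
  have "{(n, m). 0 \<le> n \<and> n \<le> T * e \<and> n * c \<le> m * e \<and> m * e \<le> n * c + (T * D) * e} = Sigma {0..T * e} ?M"
    by auto
  moreover have "card (Sigma {0..T * e} ?M) = (\<Sum>n\<in>{0..T * e}. card (?M n))"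
    using card_int_interval(1)[OF assms(1) TD] by (intro card_SigmaI) auto
  ultimately have "int (card {(n, m). 0 \<le> n \<and> n \<le> T * e \<and> n * c \<le> m * e \<and> m * e \<le> n * c + (T * D) * e})
     = (\<Sum>n\<in>{0..T * e}. int (card (?M n)))" by (simp only: of_nat_sum)
  also have "\<dots> = (\<Sum>n\<in>{0..T * e}. T * D + of_bool (e dvd n * c))"
    by (simp only: card_int_interval(2)[OF assms(1) TD])
  also have "\<dots> = (T * e + 1) * (T * D) + int (card {n \<in> {0..T * e}. e dvd n * c})"
    using assms by (simp add: sum.distrib Int_def)
  also have "\<dots> = (T * e + 1) * (T * D) + (T * gcd c e + 1)"
    using card_multiples_dvd[OF assms(1,3)] by simp
  finally show ?thesis by (simp add: algebra_simps power2_eq_square)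
qed

section \<open>Planar lattices in four-space\<close>

lemma Ints_inner:
  assumes "x \<in> int_lattice" "y \<in> int_lattice"
  shows "x \<bullet> y \<in> \<int>"
  using assms by (auto simp: inner_vec_def int_lattice_def intro!: Ints_sum Ints_mult)

text \<open>The combination lies in the subspace S, so it is a lattice point with integer
  coordinates, and independence makes coordinates unique.\<close>

lemma lattice_basis2_coeffs_Ints:
  assumes B: "lattice_basis2 (int_lattice \<inter> S) w1 w2" and S: "subspace S"
    and xy: "x *\<^sub>R w1 + y *\<^sub>R w2 \<in> int_lattice"
  shows "x \<in> \<int>" "y \<in> \<int>"
proof -
  have L: "int_lattice \<inter> S = {of_int a *\<^sub>R w1 + of_int b *\<^sub>R w2 | a b :: int. True}"
    and ind: "\<And>a b. a *\<^sub>R w1 + b *\<^sub>R w2 = 0 \<Longrightarrow> a = 0 \<and> b = 0"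
    using B unfolding lattice_basis2_def by auto
  have "w1 = of_int 1 *\<^sub>R w1 + of_int 0 *\<^sub>R w2" "w2 = of_int 0 *\<^sub>R w1 + of_int 1 *\<^sub>R w2" by simp_all
  then have "w1 \<in> int_lattice \<inter> S" "w2 \<in> int_lattice \<inter> S" unfolding L by blast+
  then have "x *\<^sub>R w1 + y *\<^sub>R w2 \<in> int_lattice \<inter> S"
    using xy S by (simp add: subspace_add subspace_scale)
  then obtain a b :: int where "x *\<^sub>R w1 + y *\<^sub>R w2 = of_int a *\<^sub>R w1 + of_int b *\<^sub>R w2"
    unfolding L by blast
  then have "(x - of_int a) *\<^sub>R w1 + (y - of_int b) *\<^sub>R w2 = 0" by (simp add: algebra_simps)
  from ind[OF this] show "x \<in> \<int>" "y \<in> \<int>" by auto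
qed

lemma lattice_basis2_mem:
  assumes "lattice_basis2 L w1 w2" "p \<in> L"
  obtains a b :: int where "p = of_int a *\<^sub>R w1 + of_int b *\<^sub>R w2"
  using assms unfolding lattice_basis2_def by auto

lemma lattice_basis2_in:
  assumes "lattice_basis2 L w1 w2"
  shows "of_int a *\<^sub>R w1 + of_int b *\<^sub>R w2 \<in> L"
  using assms unfolding lattice_basis2_def by auto

text \<open>Real counterpart of \<open>hq_minors\<close>, applicable to basis vectors that are not
  given as quaternions.\<close>

definition minor2 :: "real^4 \<Rightarrow> real^4 \<Rightarrow> 4 \<Rightarrow> 4 \<Rightarrow> real" where
  "minor2 x y r s = x $ r * y $ s - x $ s * y $ r"

text \<open>Over all index pairs, each real minor is zero or, up to sign, an entry of
  \<open>hq_minors\<close>.\<close>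

lemma minor2_hq_vec_Ints_iff:
  assumes "d \<noteq> 0"
  shows "(\<forall>r s. minor2 (hq_vec p) (hq_vec q) r s / of_int d \<in> \<int>) \<longleftrightarrow> (\<forall>m \<in> set (hq_minors p q). d dvd m)"
proof -
  obtain a b c e a' b' c' e' where pq: "p = HQ a b c e" "q = HQ a' b' c' e'" by (cases p, cases q)
  have "(of_int k * of_int l - of_int m * of_int n) / real_of_int d \<in> \<int> \<longleftrightarrow> d dvd k * l - m * n" for k l m n
    using assms of_int_div_of_int_in_Ints_iff[of "k * l - m * n" d, where 'a = real] by simp
  then show ?thesis
    by (auto simp: pq minor2_def forall_4 vector_4 dvd_diff_commute mult.commute)
qed

text \<open>For fixed r, the combination of \<open>w1\<close>, \<open>w2\<close> with coefficients
  \<open>- w2 $ r / h\<close> and \<open>w1 $ r / h\<close> has the minors over h as its entries, so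
  it is integral and its coefficients are integers. Hence \<open>w1 / h\<close> is integral, and its
  coefficient \<open>1 / h\<close> must be an integer.\<close>

lemma lattice_basis2_minors_coprime:
  assumes B: "lattice_basis2 (int_lattice \<inter> S) w1 w2" and S: "subspace S"
    and h: "h > 0" "\<And>r s. minor2 w1 w2 r s / of_int h \<in> \<int>"
  shows "h = (1::int)"
proof -
  have "w1 $ r / of_int h \<in> \<int>" for r
  proof -
    have "(- (w2 $ r / of_int h)) *\<^sub>R w1 + (w1 $ r / of_int h) *\<^sub>R w2 \<in> int_lattice"
      using h(2)[of r] by (simp add: int_lattice_def minor2_def diff_divide_distrib mult.commute)
    from lattice_basis2_coeffs_Ints(2)[OF B S this] show ?thesis .
  qed
  then have "(1 / of_int h) *\<^sub>R w1 + 0 *\<^sub>R w2 \<in> int_lattice" by (simp add: int_lattice_def)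
  from lattice_basis2_coeffs_Ints(1)[OF B S this] have "of_int 1 / real_of_int h \<in> \<int>" by simp
  then show ?thesis using h(1) unfolding of_int_div_of_int_in_Ints_iff by auto
qed

text \<open>The hypothesis on g says that g is the gcd of the minors of u and v. These are the
  minors of the basis times the determinant \<open>\<Delta>\<close>, and the minors of a basis have
  no common factor.\<close>

lemma lattice_basis2_index:
  fixes a b c d g :: int
  assumes B: "lattice_basis2 (int_lattice \<inter> S) w1 w2" and S: "subspace S"
    and u: "u = of_int a *\<^sub>R w1 + of_int b *\<^sub>R w2" and v: "v = of_int c *\<^sub>R w1 + of_int d *\<^sub>R w2"
    and g: "g > 0" "\<And>k. k > 0 \<Longrightarrow> (\<forall>r s. minor2 u v r s / of_int k \<in> \<int>) \<longleftrightarrow> k dvd g"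
  shows "\<bar>a * d - b * c\<bar> = g"
proof -
  define \<Delta> where "\<Delta> = a * d - b * c"
  have m: "minor2 u v r s = of_int \<Delta> * minor2 w1 w2 r s" for r s
    by (simp add: u v \<Delta>_def minor2_def algebra_simps)
  have "w1 \<in> int_lattice" "w2 \<in> int_lattice"
    using lattice_basis2_in[OF B, of 1 0] lattice_basis2_in[OF B, of 0 1] by auto
  then have mI: "minor2 w1 w2 r s \<in> \<int>" for r s by (auto simp: minor2_def int_lattice_def)
  have nz: "\<Delta> \<noteq> 0"
  proof
    assume "\<Delta> = 0"
    \<comment> \<open>If \<open>\<Delta>\<close> vanished, all minors would be 0 and every positive
      k would divide g.\<close>
    then have "g + 1 dvd g" using g(1) by (subst g(2)[symmetric]) (auto simp: m)
    then show False using g(1) zdvd_imp_le by fastforce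
  qed
  have "\<forall>r s. minor2 u v r s / of_int \<bar>\<Delta>\<bar> \<in> \<int>"
    using nz mI by (auto simp: m abs_if)
  then have "\<bar>\<Delta>\<bar> dvd g" using g(2)[of "\<bar>\<Delta>\<bar>"] nz by simp
  then obtain h where h: "g = \<bar>\<Delta>\<bar> * h" by blast
  have h0: "h > 0" using h g(1) nz by (simp add: zero_less_mult_iff)
  have "minor2 w1 w2 r s / of_int h \<in> \<int>" for r s
  proof -
    have "minor2 u v r s / of_int g \<in> \<int>" using g(2)[OF g(1)] by simp
    also have "minor2 u v r s / of_int g = sgn (of_int \<Delta>) * (minor2 w1 w2 r s / of_int h)"
      using nz by (simp add: m h abs_if sgn_if)
    finally show ?thesis using nz by (auto simp: sgn_if split: if_splits)
  qed
  then have "h = 1" using lattice_basis2_minors_coprime[OF B S h0] by blast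
  then show ?thesis using h \<Delta>_def by simp
qed

text \<open>The Gram determinant is multiplied by the square of the determinant of the
  substitution.\<close>

lemma par_area_change_basis:
  "par_area (a *\<^sub>R w1 + b *\<^sub>R w2) (c *\<^sub>R w1 + d *\<^sub>R w2) = \<bar>a * d - b * c\<bar> * par_area w1 w2"
proof -
  have "((a *\<^sub>R w1 + b *\<^sub>R w2) \<bullet> (a *\<^sub>R w1 + b *\<^sub>R w2)) * ((c *\<^sub>R w1 + d *\<^sub>R w2) \<bullet> (c *\<^sub>R w1 + d *\<^sub>R w2))
      - ((a *\<^sub>R w1 + b *\<^sub>R w2) \<bullet> (c *\<^sub>R w1 + d *\<^sub>R w2))\<^sup>2
    = (a * d - b * c)\<^sup>2 * ((w1 \<bullet> w1) * (w2 \<bullet> w2) - (w1 \<bullet> w2)\<^sup>2)"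
    by (simp add: inner_add_left inner_add_right inner_commute[of w2 w1] power2_eq_square algebra_simps)
  then show ?thesis by (simp add: par_area_def real_sqrt_mult)
qed

text \<open>The second basis vector is one whose coordinate along q is minimal positive; orthogonality makes
  these coordinates multiples of \<open>1 / |q|^2\<close>.\<close>

lemma exists_adapted_basis:
  assumes orth: "hq_vec p \<bullet> hq_vec q = 0" and nz: "hq_vec q \<noteq> 0" and D: "hq_content p > 0"
  obtains w and c e :: int
  where "lattice_basis2 (int_lattice \<inter> span {hq_vec p, hq_vec q}) ((1 / of_int (hq_content p)) *\<^sub>R hq_vec p) w"
    and "e > 0" and "hq_vec q = of_int c *\<^sub>R ((1 / of_int (hq_content p)) *\<^sub>R hq_vec p) + of_int e *\<^sub>R w"
proof -
  define u v D w1 where "u = hq_vec p" and "v = hq_vec q" and "D = hq_content p"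
    and "w1 = (1 / real_of_int D) *\<^sub>R u"
  have uv: "u \<bullet> v = 0" "v \<bullet> u = 0" "v \<noteq> 0" "D > 0" using assms by (auto simp: u_def v_def D_def inner_commute)
  have uL: "u \<in> int_lattice" "v \<in> int_lattice" by (auto simp: u_def v_def hq_vec_in_int_lattice)
  have scale: "r *\<^sub>R u \<in> int_lattice \<longleftrightarrow> r * of_int D \<in> \<int>" for r
    by (simp add: u_def D_def scaleR_hq_vec_in_int_lattice_iff)
  have uw: "r *\<^sub>R u = (r * of_int D) *\<^sub>R w1" for r using uv(4) by (simp add: w1_def)
  have w1L: "w1 \<in> int_lattice" unfolding w1_def scale using uv(4) by simp
  \<comment> \<open>If u were 0, the multiple of u by 1/(2D) would be integral, which would make 1/2
    an integer.\<close>
  have u0: "u \<noteq> 0" using scale[of "1 / (2 * of_int D)"] uv(4) by (auto simp: int_lattice_def)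
  obtain M :: int where M: "v \<bullet> v = of_int M" using Ints_inner[OF uL(2,2)] by (auto elim: Ints_cases)
  have M0: "M > 0" using M uv(3) by (metis inner_gt_zero_iff of_int_0_less_iff)
  \<comment> \<open>Numerators of the v-coordinates of lattice points over the denominator M. They
    form a subgroup of the integers, generated by its least positive element
    \<open>k0\<close>.\<close>
  define K where "K = {k::int. \<exists>x. x *\<^sub>R u + (of_int k / of_int M) *\<^sub>R v \<in> int_lattice}"
  have MK: "M \<in> K" unfolding K_def using M0 uL by (auto intro!: exI[of _ 0])
  have K_diff: "k - n * l \<in> K" if kl: "k \<in> K" "l \<in> K" for k l n
  proof -
    obtain x y where h: "x *\<^sub>R u + (of_int k / of_int M) *\<^sub>R v \<in> int_lattice" "y *\<^sub>R u + (of_int l / of_int M) *\<^sub>R v \<in> int_lattice"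
      using kl unfolding K_def by blast
    have "(x - of_int n * y) *\<^sub>R u + (of_int (k - n * l) / of_int M) *\<^sub>R v
      = (x *\<^sub>R u + (of_int k / of_int M) *\<^sub>R v) - of_int n *\<^sub>R (y *\<^sub>R u + (of_int l / of_int M) *\<^sub>R v)"
      by (simp add: algebra_simps diff_divide_distrib)
    then have "(x - of_int n * y) *\<^sub>R u + (of_int (k - n * l) / of_int M) *\<^sub>R v \<in> int_lattice"
      using int_lattice_closed(2)[OF h(1) int_lattice_closed(3)[OF h(2,2)]] by metis
    then show ?thesis unfolding K_def by blast
  qed
  have "\<exists>k. k \<in> K \<and> k > 0" using MK M0 by blast
  then obtain k0 where k0: "k0 \<in> K" "k0 > 0" and min: "\<And>k. k \<in> K \<Longrightarrow> k > 0 \<Longrightarrow> nat k0 \<le> nat k"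
    using ex_has_least_nat[of "\<lambda>k. k \<in> K \<and> k > 0" _ nat] by blast
  have k0_dvd: "k0 dvd k" if "k \<in> K" for k
  proof -
    have "k mod k0 \<in> K" using K_diff[OF that k0(1), of "k div k0"] by (simp add: minus_div_mult_eq_mod)
    moreover have "nat (k mod k0) < nat k0" using k0(2) by simp
    ultimately have "\<not> 0 < k mod k0" using min by (meson leD)
    then have "k mod k0 = 0" using pos_mod_sign[OF k0(2), of k] by linarith
    then show ?thesis by auto
  qed
  obtain x0 where x0: "x0 *\<^sub>R u + (of_int k0 / of_int M) *\<^sub>R v \<in> int_lattice" using k0(1) unfolding K_def by blast
  define w where "w = x0 *\<^sub>R u + (of_int k0 / of_int M) *\<^sub>R v"
  have wL: "w \<in> int_lattice" using x0 by (simp add: w_def)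
  \<comment> \<open>Subtracting \<open>b\<close> times w removes the v-coordinate; what remains is
    an integral multiple of u, hence an integer multiple of the primitive vector
    \<open>w1\<close>.\<close>
  have expand: "\<exists>a. p = of_int a *\<^sub>R w1 + of_int b *\<^sub>R w"
    if p: "p \<in> int_lattice" "p = \<alpha> *\<^sub>R u + (of_int (k0 * b) / of_int M) *\<^sub>R v" for p \<alpha> and b :: int
  proof -
    have e: "p - of_int b *\<^sub>R w = (\<alpha> - of_int b * x0) *\<^sub>R u"
      by (simp add: p(2) w_def algebra_simps)
    moreover have "p - of_int b *\<^sub>R w \<in> int_lattice" using p(1) wL by (intro int_lattice_closed)
    ultimately obtain a where "(\<alpha> - of_int b * x0) * of_int D = of_int a" using scale by (auto elim: Ints_cases)
    then have "p - of_int b *\<^sub>R w = of_int a *\<^sub>R w1" using e uw by simp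
    then show ?thesis by (metis diff_add_cancel)
  qed
  have "lattice_basis2 (int_lattice \<inter> span {u, v}) w1 w"
    unfolding lattice_basis2_def
  proof (intro conjI allI impI)
    fix a b :: real assume 0: "a *\<^sub>R w1 + b *\<^sub>R w = 0"
    then have "(a *\<^sub>R w1 + b *\<^sub>R w) \<bullet> v = 0" by simp
    then have b: "b = 0" using uv M M0 k0(2) by (simp add: w1_def w_def inner_add_left)
    then show "a = 0" "b = 0" using 0 u0 uv(4) by (auto simp: w1_def)
  next
    have span: "w1 \<in> span {u, v}" "w \<in> span {u, v}"
      unfolding w1_def w_def by (intro span_add span_scale span_base; simp)+
    show "int_lattice \<inter> span {u, v} = {of_int a *\<^sub>R w1 + of_int b *\<^sub>R w | a b :: int. True}"
    proof (intro set_eqI iffI)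
      fix p assume p: "p \<in> int_lattice \<inter> span {u, v}"
      then obtain \<alpha> \<beta> where ab: "p = \<alpha> *\<^sub>R u + \<beta> *\<^sub>R v"
        unfolding span_insert span_empty by (auto simp: algebra_simps)
      \<comment> \<open>Pairing with v kills the u-part, so \<open>\<beta> * M\<close> is an
        integer.\<close>
      have "p \<bullet> v = \<beta> * of_int M" using uv M by (simp add: ab inner_add_left)
      moreover have "p \<bullet> v \<in> \<int>" using p uL by (auto intro: Ints_inner)
      ultimately obtain k where k: "\<beta> * of_int M = of_int k" by (auto elim: Ints_cases)
      then have \<beta>: "\<beta> = of_int k / of_int M" using M0 by (simp add: field_simps)
      then have "k \<in> K" unfolding K_def using p ab by auto
      then obtain b where "k = k0 * b" using k0_dvd by blast
      then show "p \<in> {of_int a *\<^sub>R w1 + of_int b *\<^sub>R w | a b :: int. True}"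
        using expand[of p \<alpha> b] p ab \<beta> by auto
    next
      fix p assume "p \<in> {of_int a *\<^sub>R w1 + of_int b *\<^sub>R w | a b :: int. True}"
      then show "p \<in> int_lattice \<inter> span {u, v}"
        using span w1L wL by (auto intro!: int_lattice_closed span_add span_scale)
    qed
  qed
  \<comment> \<open>The vector v itself has numerator M, so its coefficient at w is
    \<open>M / k0\<close>.\<close>
  moreover obtain e where e: "M = k0 * e" using k0_dvd[OF MK] by blast
  moreover have "e > 0" using e M0 k0(2) by (simp add: zero_less_mult_iff)
  moreover obtain c where "v = of_int c *\<^sub>R w1 + of_int e *\<^sub>R w"
    using expand[OF uL(2), of 0 e] M0 unfolding e[symmetric] by auto
  ultimately show thesis using that unfolding u_def v_def w1_def D_def by blast
qed

text \<open>A real r keeps the vector integral exactly when \<open>r * c\<close> and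
  \<open>r * e\<close> are integers. Testing the reciprocals of the content and of
  \<open>gcd c e\<close> gives divisibility both ways.\<close>

lemma hq_content_in_basis:
  fixes c e :: int
  assumes B: "lattice_basis2 (int_lattice \<inter> S) w1 w2" and S: "subspace S"
    and q: "hq_vec q = of_int c *\<^sub>R w1 + of_int e *\<^sub>R w2" and e: "e > 0"
  shows "hq_content q = gcd c e"
proof (rule zdvd_antisym_nonneg)
  have iff: "r * of_int (hq_content q) \<in> \<int> \<longleftrightarrow> r * of_int c \<in> \<int> \<and> r * of_int e \<in> \<int>" for r :: real
  proof -
    have rq: "r *\<^sub>R hq_vec q = (r * of_int c) *\<^sub>R w1 + (r * of_int e) *\<^sub>R w2" by (simp add: q algebra_simps)
    show ?thesis unfolding scaleR_hq_vec_in_int_lattice_iff[symmetric]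
    proof
      assume "r *\<^sub>R hq_vec q \<in> int_lattice"
      then show "r * of_int c \<in> \<int> \<and> r * of_int e \<in> \<int>"
        using lattice_basis2_coeffs_Ints[OF B S] unfolding rq by blast
    next
      assume "r * of_int c \<in> \<int> \<and> r * of_int e \<in> \<int>"
      then obtain k l :: int where "r * of_int c = of_int k" "r * of_int e = of_int l" by (auto elim!: Ints_cases)
      then show "r *\<^sub>R hq_vec q \<in> int_lattice" using lattice_basis2_in[OF B, of k l] unfolding rq by simp
    qed
  qed
  show "hq_content q \<ge> 0" by (rule hq_content_nonneg)
  show "gcd c e \<ge> 0" by simp
  have div: "(1 / real_of_int k) * of_int n \<in> \<int> \<longleftrightarrow> k dvd n" if "k \<noteq> 0" for k n
    using of_int_div_of_int_in_Ints_iff[of n k, where 'a = real] that by simp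
  \<comment> \<open>With content 0 every r would be admissible, contradicted by
    \<open>r = 1 / (2 * e)\<close>.\<close>
  have nz: "hq_content q \<noteq> 0"
  proof
    assume "hq_content q = 0"
    then have "(1 / real_of_int (2 * e)) * of_int e \<in> \<int>" using iff[of "1 / real_of_int (2 * e)"] by simp
    then have "2 * e dvd e" using div e by simp
    then show False using e zdvd_imp_le by fastforce
  qed
  show "hq_content q dvd gcd c e" using iff[of "1 / of_int (hq_content q)"] div[OF nz] nz by simp
  show "gcd c e dvd hq_content q"
    using iff[of "1 / of_int (gcd c e)"] div[of "gcd c e"] e by simp
qed

text \<open>In basis coordinates the dilated parallelogram becomes the sheared rectangle; n is the
  coefficient of \<open>w2\<close>, so columns are lines parallel to u.\<close>

lemma card_lattice_points_parallelogram:
  fixes c e D :: int and t :: nat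
  assumes B: "lattice_basis2 (int_lattice \<inter> S) w1 w2" and S: "subspace S"
    and u: "u = of_int D *\<^sub>R w1" and v: "v = of_int c *\<^sub>R w1 + of_int e *\<^sub>R w2"
    and pos: "e > 0" "D > 0" "t > 0"
  shows "int (card ((\<lambda>x. real t *\<^sub>R x) ` (convex hull {0, u, v, u + v}) \<inter> int_lattice))
    = D * e * (int t)\<^sup>2 + (D + gcd c e) * int t + 1"
proof -
  define T where "T = int t"
  define R where "R = {(n, m). 0 \<le> n \<and> n \<le> T * e \<and> n * c \<le> m * e \<and> m * e \<le> n * c + (T * D) * e}"
  define f where "f = (\<lambda>(n, m). of_int m *\<^sub>R w1 + of_int n *\<^sub>R w2)"
  have T: "real t = of_int T" "T > 0" using pos by (auto simp: T_def)
  have ind: "\<And>a b. a *\<^sub>R w1 + b *\<^sub>R w2 = 0 \<Longrightarrow> a = 0 \<and> b = 0"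
    using B unfolding lattice_basis2_def by auto
  have "inj_on f R"
  proof (rule inj_onI, clarify)
    fix n m n' m' assume "f (n, m) = f (n', m')"
    then have "(of_int m - of_int m') *\<^sub>R w1 + (of_int n - of_int n') *\<^sub>R w2 = 0"
      by (simp add: f_def algebra_simps)
    from ind[OF this] show "n = n' \<and> m = m'" by simp
  qed
  moreover have "(\<lambda>x. real t *\<^sub>R x) ` (convex hull {0, u, v, u + v}) \<inter> int_lattice = f ` R"
  proof (intro set_eqI iffI)
    fix p assume p: "p \<in> (\<lambda>x. real t *\<^sub>R x) ` (convex hull {0, u, v, u + v}) \<inter> int_lattice"
    then obtain x y where xy: "0 \<le> x" "x \<le> 1" "0 \<le> y" "y \<le> 1" "p = real t *\<^sub>R (x *\<^sub>R u + y *\<^sub>R v)"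
      unfolding parallelogram_hull by auto
    have pe: "p = (T * (x * D + y * c)) *\<^sub>R w1 + (T * y * e) *\<^sub>R w2"
      by (simp add: xy u v T algebra_simps)
    then obtain m n :: int where mn: "T * (x * D + y * c) = of_int m" "T * y * e = of_int n"
      using lattice_basis2_coeffs_Ints[OF B S, of "T * (x * D + y * c)" "T * y * e"] p
      by (auto elim!: Ints_cases)
    have "real_of_int n \<ge> 0" using T pos xy by (simp flip: mn)
    moreover have "real_of_int n \<le> of_int (T * e)" using T pos xy by (simp flip: mn)
    \<comment> \<open>Cramer's rule: \<open>m * e - n * c\<close> eliminates y, so the bounds on x
      become the bounds on m.\<close>
    moreover have d: "real_of_int (m * e - n * c) = x * (T * D * e)" by (simp add: algebra_simps flip: mn)
    have "real_of_int (m * e - n * c) \<ge> 0" unfolding d using T pos xy by simp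
    moreover have "real_of_int (m * e - n * c) \<le> of_int (T * D * e)" unfolding d using T pos xy
      by (simp add: mult_left_le_one_le)
    ultimately have "0 \<le> n" "n \<le> T * e" "0 \<le> m * e - n * c" "m * e - n * c \<le> T * D * e"
      by (simp_all only: of_int_le_iff of_int_0_le_iff)
    then have "(n, m) \<in> R" by (simp add: R_def)
    then show "p \<in> f ` R" by (intro image_eqI[of _ _ "(n, m)"]) (simp_all add: pe mn f_def)
  next
    fix p assume "p \<in> f ` R"
    then obtain n m where nm: "0 \<le> n" "n \<le> T * e" "0 \<le> m * e - n * c" "m * e - n * c \<le> T * D * e"
      "p = of_int m *\<^sub>R w1 + of_int n *\<^sub>R w2" by (auto simp: R_def f_def)
    \<comment> \<open>The same linear system solved for the parameters of the hull.\<close>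
    define x y where "x = real_of_int (m * e - n * c) / of_int (T * D * e)" and "y = real_of_int n / of_int (T * e)"
    have pos': "0 < T * D * e" "0 < T * e" using T pos by auto
    have "0 \<le> x" "0 \<le> y" unfolding x_def y_def using nm pos' by (simp_all only: of_int_0_le_iff zero_le_divide_iff) auto
    moreover have "x \<le> 1" unfolding x_def using nm(4) pos'(1) by (simp only: divide_le_eq_1_pos of_int_0_less_iff of_int_le_iff)
    moreover have "y \<le> 1" unfolding y_def using nm(2) pos'(2) by (simp only: divide_le_eq_1_pos of_int_0_less_iff of_int_le_iff)
    moreover have "p = real t *\<^sub>R (x *\<^sub>R u + y *\<^sub>R v)"
    proof -
      have "T * (x * D + y * c) = m" "T * y * e = n"
        using T pos by (simp_all add: x_def y_def field_simps)
      moreover have "real t *\<^sub>R (x *\<^sub>R u + y *\<^sub>R v) = (T * (x * D + y * c)) *\<^sub>R w1 + (T * y * e) *\<^sub>R w2"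
        by (simp add: u v T algebra_simps)
      ultimately show ?thesis using nm(5) by simp
    qed
    moreover have "p \<in> int_lattice" using lattice_basis2_in[OF B, of m n] nm(5) by simp
    ultimately show "p \<in> (\<lambda>x. real t *\<^sub>R x) ` (convex hull {0, u, v, u + v}) \<inter> int_lattice"
      unfolding parallelogram_hull by blast
  qed
  ultimately have "card ((\<lambda>x. real t *\<^sub>R x) ` (convex hull {0, u, v, u + v}) \<inter> int_lattice) = card R"
    by (simp only: card_image)
  moreover have "int (card R) = D * e * T\<^sup>2 + (D + gcd c e) * T + 1"
    unfolding R_def using pos T(2) by (intro card_sheared_rectangle) auto
  ultimately show ?thesis by (simp only: T_def)
qed

section \<open>The orthogonal vectors u and v, and the assembly of the result\<close>

lemma hq_vec_inner_self: "hq_vec q \<bullet> hq_vec q = of_int (hq_norm q)"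
  by (cases q) (simp add: inner_vec_def sum_4 vector_4 power2_eq_square)

text \<open>Multiplying by q1 on the left and by the conjugate of q2 on the right scales all inner
  products by the same factor, and j is orthogonal to k.\<close>

lemma hq_vec_orthogonal:
  "hq_vec (hq_mult (hq_mult q1 hq_j) (hq_cnj q2)) \<bullet> hq_vec (hq_mult (hq_mult q1 hq_k) (hq_cnj q2)) = 0"
  by (cases q1; cases q2) (simp add: inner_vec_def sum_4 vector_4 hq_j_def hq_k_def algebra_simps)

lemma hq_odd_norm_pos: "hq_odd q \<Longrightarrow> hq_norm q > 0"
proof -
  assume "hq_odd q"
  moreover have "hq_norm q \<ge> 0" by (cases q) simp
  ultimately show ?thesis by (cases "hq_norm q = 0") (auto simp: hq_odd_def)
qed

theorem theorem2p12:
  fixes q1 q2 :: hq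
  assumes "hq_odd q1" and "hq_odd q2"
    and "\<And>\<alpha> \<beta>. \<alpha>^2 + \<beta>^2 > 1 \<Longrightarrow> \<not> hq_right_dvd (HQ \<alpha> \<beta> 0 0) q1"
    and "\<And>\<alpha> \<beta>. \<alpha>^2 + \<beta>^2 > 1 \<Longrightarrow> \<not> hq_right_dvd (HQ \<alpha> \<beta> 0 0) q2"
  defines "u \<equiv> hq_mult (hq_mult q1 hq_j) (hq_cnj q2)"
    and "v \<equiv> hq_mult (hq_mult q1 hq_k) (hq_cnj q2)"
  defines "L \<equiv> int_lattice \<inter> span {hq_vec u, hq_vec v}"
    and "P \<equiv> convex hull {0, hq_vec u, hq_vec v, hq_vec u + hq_vec v}"
  shows "(\<exists>w1 w2. lattice_basis2 L w1 w2)
       \<and> (\<forall>w1 w2. lattice_basis2 L w1 w2 \<longrightarrow>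
            par_area w1 w2 = of_int (lcm (hq_norm q1) (hq_norm q2)))
       \<and> (\<forall>t::nat. t > 0 \<longrightarrow>
            int (card ((\<lambda>x. real t *\<^sub>R x) ` P \<inter> int_lattice))
            = gcd (hq_norm q1) (hq_norm q2) * int t ^ 2
              + (hq_content u + hq_content v) * int t + 1)"
proof -
  define N1 N2 g where "N1 = hq_norm q1" and "N2 = hq_norm q2" and "g = gcd N1 N2"
  have pos: "N1 > 0" "N2 > 0" "g > 0"
    using assms(1,2)[THEN hq_odd_norm_pos] by (auto simp: N1_def N2_def g_def)
  have cnj: "hq_norm (hq_cnj q2) = N2" unfolding N2_def by (cases q2) simp
  have norms: "hq_norm u = N1 * N2" "hq_norm v = N1 * N2"
    by (simp_all add: u_def v_def hq_norm_mult cnj hq_j_def hq_k_def N1_def)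
  have orth: "hq_vec u \<bullet> hq_vec v = 0" unfolding u_def v_def by (rule hq_vec_orthogonal)
  have inner: "hq_vec u \<bullet> hq_vec u = of_int (N1 * N2)" "hq_vec v \<bullet> hq_vec v = of_int (N1 * N2)"
    by (simp_all only: hq_vec_inner_self norms)
  have v0: "hq_vec v \<noteq> 0" using inner(2) pos by auto
  have "hq_content u \<noteq> 0"
  proof
    assume "hq_content u = 0"
    then have "hq_norm u = 0" by (cases u) simp
    then show False using norms pos by simp
  qed
  then have D: "hq_content u > 0" using hq_content_nonneg[of u] by simp
  have c: "hq_content (hq_mult (hq_mult q1 hq_i) (hq_cnj q1)) = 1"
    "hq_content (hq_mult (hq_mult q2 hq_i) (hq_cnj q2)) = 1"
    using hq_content_conj_i[OF assms(1,3)] hq_content_conj_i[OF assms(2,4)] by blast+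
  have minors: "(\<forall>r s. minor2 (hq_vec u) (hq_vec v) r s / of_int k \<in> \<int>) \<longleftrightarrow> k dvd g" if "k > 0" for k
    using minor2_hq_vec_Ints_iff[of k u v] dvd_minors_iff[OF _ c, of k] that assms(1)
    unfolding u_def v_def g_def N1_def N2_def hq_odd_def by simp
  have S: "subspace (span {hq_vec u, hq_vec v})" by simp
  obtain w c e where w: "lattice_basis2 L ((1 / of_int (hq_content u)) *\<^sub>R hq_vec u) w" "e > 0"
    "hq_vec v = of_int c *\<^sub>R ((1 / of_int (hq_content u)) *\<^sub>R hq_vec u) + of_int e *\<^sub>R w"
    using exists_adapted_basis[OF orth v0 D] unfolding L_def by metis
  have u: "hq_vec u = of_int (hq_content u) *\<^sub>R ((1 / of_int (hq_content u)) *\<^sub>R hq_vec u)"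
    using D by simp
  then have u': "hq_vec u = of_int (hq_content u) *\<^sub>R ((1 / of_int (hq_content u)) *\<^sub>R hq_vec u) + of_int 0 *\<^sub>R w"
    by simp
  \<comment> \<open>In the adapted basis u and v have a triangular coefficient matrix with
    determinant \<open>hq_content u * e\<close>.\<close>
  have De: "hq_content u * e = g"
    using lattice_basis2_index[OF w(1)[unfolded L_def] S u' w(3) pos(3) minors] D w(2) by simp
  \<comment> \<open>The rectangle on u and v has area \<open>N1 * N2\<close> and consists of g
    fundamental domains, whichever basis is chosen.\<close>
  have area: "par_area w1 w2 = of_int (lcm N1 N2)" if B: "lattice_basis2 L w1 w2" for w1 w2
  proof -
    have "hq_vec u \<in> L" "hq_vec v \<in> L"
      unfolding L_def by (auto simp: hq_vec_in_int_lattice intro: span_base)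
    then obtain a b c d :: int where uv: "hq_vec u = of_int a *\<^sub>R w1 + of_int b *\<^sub>R w2"
      "hq_vec v = of_int c *\<^sub>R w1 + of_int d *\<^sub>R w2" using lattice_basis2_mem[OF B] by metis
    have "\<bar>a * d - b * c\<bar> = g"
      using lattice_basis2_index[OF B[unfolded L_def] S uv pos(3) minors] by simp
    then have "\<bar>real_of_int a * real_of_int d - real_of_int b * real_of_int c\<bar> = of_int g"
      by (metis of_int_abs of_int_diff of_int_mult)
    then have "of_int g * par_area w1 w2 = par_area (hq_vec u) (hq_vec v)"
      unfolding uv par_area_change_basis by simp
    also have "\<dots> = sqrt (real_of_int (N1 * N2) * real_of_int (N1 * N2))"
      unfolding par_area_def inner orth by simp
    also have "\<dots> = of_int (N1 * N2)" using pos by (subst real_sqrt_abs2) simp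
    also have "N1 * N2 = g * lcm N1 N2" using pos gcd_mult_lcm[of N1 N2] by (simp add: g_def)
    finally show ?thesis using pos by simp
  qed
  \<comment> \<open>The leading coefficient is \<open>De\<close>, and the linear term uses that
    \<open>gcd c e\<close> is the content of v.\<close>
  have "int (card ((\<lambda>x. real t *\<^sub>R x) ` P \<inter> int_lattice))
      = g * int t ^ 2 + (hq_content u + hq_content v) * int t + 1" if "t > 0" for t
    using card_lattice_points_parallelogram[OF w(1)[unfolded L_def] S u w(3) w(2) D that]
      hq_content_in_basis[OF w(1)[unfolded L_def] S w(3) w(2)] De unfolding P_def by simp
  then show ?thesis using w(1) area unfolding g_def N1_def N2_def by blast
qed

end
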